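(* Let $\varrho$ be a substitution on $\{{\tt a},{\tt b}\}$ with substitution matrix $M_\varrho\in M_2(\mathbb{Z})$ such that both ${\tt a}$ and ${\tt b}$ occur in $\varrho({\tt a}{\tt b})$. If ${\tt w}\in\mathcal{W}$ is any word such that ${\rm Freq}_{\tt a}({\tt w})$ exists, then \[\begin{bmatrix}{\rm Freq}_{\tt a}(\varrho({\tt w}))\\ {\rm Freq}_{\tt b}(\varrho({\tt w}))\end{bmatrix}=\frac{1}{|\varrho({\tt a})|\,{\rm Freq}_{\tt a}({\tt w})+|\varrho({\tt b})|\,{\rm Freq}_{\tt b}({\tt w})}\,M_\varrho\begin{bmatrix}{\rm Freq}_{\tt a}({\tt w})\\ {\rm Freq}_{\tt b}({\tt w})\end{bmatrix}.\] Moreover, if $M_\varrho$ is invertible and ${\rm Freq}_{\tt a}(\varrho({\tt w}))$ exists, then \[\begin{bmatrix}{\rm Freq}_{\tt a}({\tt w})\\ {\rm Freq}_{\tt b}({\tt w})\end{bmatrix}=\left\langle (M_\varrho^{-1})^T\begin{bmatrix}1\\1\end{bmatrix},\begin{bmatrix}{\rm Freq}_{\tt a}(\varrho({\tt w}))\\ {\rm Freq}_{\tt b}(\varrho({\tt w}))\end{bmatrix}\right\rangle^{-1} M_\varrho^{-1}\begin{bmatrix}{\rm Freq}_{\tt a}(\varrho({\tt w}))\\ {\rm Freq}_{\tt b}(\varrho({\tt w}))\end{bmatrix}.\]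
   Context: $\mathcal{W}$ is the set of infinite one-sided words over $\{{\tt a},{\tt b}\}$ in which both letters occur infinitely often. A substitution is a morphism of words determined by $\varrho({\tt a}),\varrho({\tt b})$, extended to infinite words by concatenation. $(M_\varrho)_{\alpha\beta}$ is the number of occurrences of $\alpha$ in $\varrho(\beta)$ (order ${\tt a},{\tt b}$). $|u|$ is the length of a word. For a word ${\tt v}$, ${\rm Freq}_\alpha({\tt v})=\lim_{m\to\infty}\#_\alpha(m)/m$ where $\#_\alpha(m)$ counts occurrences of $\alpha$ among the first $m$ letters of ${\tt v}$. $\langle\cdot,\cdot\rangle$ is the standard inner product on $\mathbb{R}^2$.
   Formalization: If ϱ sends one letter to the empty word, the first formula is claimed only when |ϱ(a)|Freq_a(w)+|ϱ(b)|Freq_b(w) is nonzero, since otherwise it is undefined (e.g. ϱ(a) empty, ϱ(b)=ab, Freq_b(w)=0); existence of the frequencies of ϱ(w) is still proved. *)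

theory Defs
  imports "HOL-Analysis.Analysis"
begin

datatype letter = La | Lb

type_synonym inf_word = "nat \<Rightarrow> letter"

type_synonym substitution = "letter \<Rightarrow> letter list"

definition inf_words_both :: "inf_word set"  ("\<W>") where
  "\<W> = {w. \<forall>\<alpha>. infinite {n. w n = \<alpha>}}"

definition word_prefix :: "nat \<Rightarrow> inf_word \<Rightarrow> letter list" where
  "word_prefix n w = map w [0..<n]"

definition subst_list :: "substitution \<Rightarrow> letter list \<Rightarrow> letter list" where
  "subst_list \<rho> u = concat (map \<rho> u)"

text \<open>
  Extension to infinite words by concatenation: the \<open>i\<close>-th letter is read off the image of the
  shortest prefix of \<open>w\<close> whose image is long enough. Images of letters may be empty; the definition
  is meaningful whenever the images of the prefixes of \<open>w\<close> have unbounded length, in particular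
  for \<open>w \<in> \<W>\<close> and \<open>\<rho>\<close> not erasing both letters.
\<close>

definition subst_word :: "substitution \<Rightarrow> inf_word \<Rightarrow> inf_word" where
  "subst_word \<rho> w =
     (\<lambda>i. subst_list \<rho> (word_prefix (LEAST n. i < length (subst_list \<rho> (word_prefix n w))) w) ! i)"

definition subst_matrix :: "substitution \<Rightarrow> real ^ 2 ^ 2" where
  "subst_matrix \<rho> = vector
     [vector [real (count_list (\<rho> La) La), real (count_list (\<rho> Lb) La)],
      vector [real (count_list (\<rho> La) Lb), real (count_list (\<rho> Lb) Lb)]]"

definition freq_seq :: "letter \<Rightarrow> inf_word \<Rightarrow> nat \<Rightarrow> real" where
  "freq_seq \<alpha> v m = real (count_list (word_prefix m v) \<alpha>) / real m"

definition freq_exists :: "letter \<Rightarrow> inf_word \<Rightarrow> bool" where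
  "freq_exists \<alpha> v \<longleftrightarrow> convergent (freq_seq \<alpha> v)"

text \<open>The value is only meaningful under \<^const>\<open>freq_exists\<close>.\<close>

definition Freq :: "letter \<Rightarrow> inf_word \<Rightarrow> real" where
  "Freq \<alpha> v = lim (freq_seq \<alpha> v)"

definition freq_vec :: "inf_word \<Rightarrow> real ^ 2" where
  "freq_vec v = vector [Freq La v, Freq Lb v]"

end

theory Submission imports Defs begin

text \<open>
  Let \<open>p\<close> and \<open>q\<close> count the letters in the prefix of length \<open>n\<close> of \<open>w\<close>. The image of this
  prefix is a prefix of \<open>\<rho>(w)\<close> with letter counts \<open>M (p, q)\<close> and length
  \<open>L = |\<rho>(a)| p + |\<rho>(b)| q\<close>. Since these lengths have bounded gaps, the frequencies in \<open>\<rho>(w)\<close>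
  can be computed along them. Dividing by \<open>n\<close> gives the first formula. Conversely, if \<open>M\<close> is
  invertible then \<open>(p, q) / L\<close> converges, and so does \<open>n / L\<close>, whose limit is positive because
  \<open>L\<close> is at most a constant times \<open>n\<close>; the quotient gives the frequencies in \<open>w\<close>.
\<close>

section \<open>Limits of ratios sampled with bounded gaps\<close>

text \<open>Between consecutive sample points both \<open>c m\<close> and \<open>l * m\<close> move
  by at most a constant depending on \<open>K\<close> and \<open>l\<close>, and this is negligible
  against \<open>m\<close>.\<close>

lemma tendsto_ratio_bounded_gaps:
  fixes c L :: "nat \<Rightarrow> nat" and l :: real
  assumes c0: "c 0 = 0"
    and c_mono: "\<And>m k. c m \<le> c (m + k)"
    and c_lip: "\<And>m k. c (m + k) \<le> c m + k"
    and L0: "L 0 = 0"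
    and L_mono: "mono L"
    and L_gap: "\<And>n. L (Suc n) \<le> L n + K"
    and L_top: "filterlim L at_top sequentially"
    and lim: "(\<lambda>n. real (c (L n)) / real (L n)) \<longlonglongrightarrow> l"
  shows "(\<lambda>m. real (c m) / real m) \<longlonglongrightarrow> l"
proof (rule LIMSEQ_I)
  fix e :: real assume e: "e > 0"
  obtain N where N: "\<And>n. n \<ge> N \<Longrightarrow> \<bar>real (c (L n)) / real (L n) - l\<bar> < e / 2"
    using LIMSEQ_D[OF lim, of "e / 2"] e by auto
  \<comment> \<open>Clearing the denominator gives an estimate that also holds when
    \<open>L n = 0\<close>, thanks to \<open>c 0 = 0\<close>.\<close>
  have N': "\<bar>real (c (L n)) - l * real (L n)\<bar> \<le> e / 2 * real (L n)" if "n \<ge> N" for n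
  proof (cases "L n = 0")
    case True then show ?thesis by (simp add: c0)
  next
    case False
    have "\<bar>real (c (L n)) - l * real (L n)\<bar> = \<bar>real (c (L n)) / real (L n) - l\<bar> * real (L n)"
      using False by (simp add: field_simps abs_if)
    also have "\<dots> \<le> e / 2 * real (L n)"
      using N[OF that] by (intro mult_right_mono) auto
    finally show ?thesis .
  qed
  \<comment> \<open>Beyond \<open>M\<close> the error caused by the gap is below
    \<open>e / 2 * m\<close>; the other half of \<open>e\<close> pays for the error at the sample
    point.\<close>
  obtain M where M: "real M > real K * (1 + \<bar>l\<bar>) / (e / 2)"
    using reals_Archimedean2 by blast
  show "\<exists>no. \<forall>m\<ge>no. norm (real (c m) / real m - l) < e"
  proof (intro exI allI impI)
    fix m assume m: "m \<ge> max (L N) (max M 1)"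
    obtain k0 where k0: "m < L k0"
      using L_top unfolding filterlim_at_top eventually_sequentially by (meson Suc_le_eq order_refl)
    \<comment> \<open>Minimality brackets \<open>m\<close> as
      \<open>L n \<le> m < L (Suc n)\<close>; \<open>k\<close> is a successor because
      \<open>L 0 = 0\<close>.\<close>
    define k where "k = (LEAST k. m < L k)"
    have k: "m < L k" unfolding k_def using k0 by (rule LeastI)
    then obtain n where n: "k = Suc n" using L0 by (cases k) auto
    have Ln: "L n \<le> m" using not_less_Least[of n "\<lambda>k. m < L k"] n k_def by auto
    have "N \<le> n"
    proof (rule ccontr)
      assume "\<not> N \<le> n"
      then have "L (Suc n) \<le> L N" by (intro monoD[OF L_mono]) simp
      then show False using k n m by simp
    qed
    define d where "d = m - L n"
    have d: "m = L n + d" "d \<le> K" using Ln k n L_gap[of n] by (auto simp: d_def)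
    have dc: "\<bar>real (c m) - real (c (L n))\<bar> \<le> real d"
      using c_mono[of "L n" d] c_lip[of "L n" d] d(1) by simp
    \<comment> \<open>The error at \<open>m\<close> is the error at the sample point plus the
      changes of \<open>c\<close> and of the linear term over the gap.\<close>
    have "real (c m) - l * real m
        = (real (c (L n)) - l * real (L n)) + (real (c m) - real (c (L n))) - l * real d"
      using d(1) by (simp add: algebra_simps)
    then have "\<bar>real (c m) - l * real m\<bar>
        \<le> \<bar>real (c (L n)) - l * real (L n)\<bar> + \<bar>real (c m) - real (c (L n))\<bar> + \<bar>l * real d\<bar>"
      by linarith
    also have "\<dots> \<le> e / 2 * real (L n) + real d + \<bar>l\<bar> * real d"
      using N'[OF \<open>N \<le> n\<close>] dc by (simp add: abs_mult)
    also have "\<dots> \<le> e / 2 * real m + real K * (1 + \<bar>l\<bar>)"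
    proof -
      have "e / 2 * real (L n) \<le> e / 2 * real m" using e Ln by simp
      moreover have "real d * (1 + \<bar>l\<bar>) \<le> real K * (1 + \<bar>l\<bar>)"
        using d(2) by (intro mult_right_mono) auto
      ultimately show ?thesis by (simp add: algebra_simps)
    qed
    also have "\<dots> < e / 2 * real m + e / 2 * real m"
    proof -
      have "real K * (1 + \<bar>l\<bar>) < e / 2 * real M" using M e by (simp add: field_simps)
      also have "\<dots> \<le> e / 2 * real m" using m e by simp
      finally show ?thesis by simp
    qed
    finally have *: "\<bar>real (c m) - l * real m\<bar> < e * real m" by simp
    have mpos: "real m > 0" using m by simp
    have "norm (real (c m) / real m - l) = \<bar>real (c m) - l * real m\<bar> / real m"
      using mpos by (simp add: field_simps abs_if)
    also have "\<dots> < e" using * mpos by (simp add: field_simps)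
    finally show "norm (real (c m) / real m - l) < e" .
  qed
qed

section \<open>Prefixes and their images\<close>

lemma word_prefix_Suc: "word_prefix (Suc n) w = word_prefix n w @ [w n]"
  by (simp add: word_prefix_def)

lemma length_word_prefix [simp]: "length (word_prefix n w) = n"
  by (simp add: word_prefix_def)

lemma subst_list_append: "subst_list \<rho> (u @ v) = subst_list \<rho> u @ subst_list \<rho> v"
  by (simp add: subst_list_def)

lemma subst_list_prefix_Suc:
  "subst_list \<rho> (word_prefix (Suc n) w) = subst_list \<rho> (word_prefix n w) @ \<rho> (w n)"
  by (simp add: word_prefix_Suc subst_list_append) (simp add: subst_list_def)

lemma count_La_plus_Lb: "count_list u La + count_list u Lb = length u"
proof (induction u)
  case (Cons x u) then show ?case by (cases x) auto
qed simp

lemma count_subst_list: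
  "count_list (subst_list \<rho> u) \<alpha>
     = count_list u La * count_list (\<rho> La) \<alpha> + count_list u Lb * count_list (\<rho> Lb) \<alpha>"
proof (induction u)
  case Nil then show ?case by (simp add: subst_list_def)
next
  case (Cons x u) then show ?case by (cases x) (auto simp: subst_list_def)
qed

lemma length_subst_list:
  "length (subst_list \<rho> u)
     = count_list u La * length (\<rho> La) + count_list u Lb * length (\<rho> Lb)"
proof (induction u)
  case Nil then show ?case by (simp add: subst_list_def)
next
  case (Cons x u) then show ?case by (cases x) (auto simp: subst_list_def)
qed

lemma subst_list_prefix_mono:
  assumes "k \<le> n"
  shows "\<exists>z. subst_list \<rho> (word_prefix n w) = subst_list \<rho> (word_prefix k w) @ z"
  using assms
proof (induction n rule: dec_induct)
  case (step n) then show ?case by (auto simp: subst_list_prefix_Suc)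
qed simp

text \<open>The \<open>LEAST\<close> index chosen for position \<open>i\<close> is at most
  \<open>n\<close>, so the image it selects is an initial segment of the image of the longer prefix
  and has the same letter at \<open>i\<close>.\<close>

lemma word_prefix_subst_word:
  "word_prefix (length (subst_list \<rho> (word_prefix n w))) (subst_word \<rho> w)
     = subst_list \<rho> (word_prefix n w)"
proof (rule nth_equalityI)
  fix i assume "i < length (word_prefix (length (subst_list \<rho> (word_prefix n w))) (subst_word \<rho> w))"
  then have i: "i < length (subst_list \<rho> (word_prefix n w))" by simp
  define k where "k = (LEAST k. i < length (subst_list \<rho> (word_prefix k w)))"
  have k: "i < length (subst_list \<rho> (word_prefix k w))"
    unfolding k_def using i by (rule LeastI)
  have "k \<le> n" unfolding k_def using i by (rule Least_le)
  then obtain z where "subst_list \<rho> (word_prefix n w) = subst_list \<rho> (word_prefix k w) @ z"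
    using subst_list_prefix_mono by blast
  then have "subst_list \<rho> (word_prefix n w) ! i = subst_word \<rho> w i"
    using k by (simp add: nth_append subst_word_def k_def)
  then show "word_prefix (length (subst_list \<rho> (word_prefix n w))) (subst_word \<rho> w) ! i
      = subst_list \<rho> (word_prefix n w) ! i"
    using i by (simp add: word_prefix_def)
qed simp

text \<open>The count is monotone, and each of the infinitely many occurrences of
  \<open>\<alpha>\<close> raises it by one.\<close>

lemma count_prefix_tendsto_at_top:
  assumes "w \<in> \<W>"
  shows "filterlim (\<lambda>n. count_list (word_prefix n w) \<alpha>) at_top sequentially"
  unfolding filterlim_at_top eventually_sequentially
proof
  fix Z
  have mono: "count_list (word_prefix k w) \<alpha> \<le> count_list (word_prefix n w) \<alpha>" if "k \<le> n" for k n
    using that by (induction n rule: dec_induct) (auto simp: word_prefix_Suc)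
  have "\<exists>N. Z \<le> count_list (word_prefix N w) \<alpha>"
  proof (induction Z)
    case (Suc Z)
    then obtain N where N: "Z \<le> count_list (word_prefix N w) \<alpha>" by blast
    have "infinite {n. w n = \<alpha>}" using assms by (simp add: inf_words_both_def)
    then obtain n where "n > N" "w n = \<alpha>" unfolding infinite_nat_iff_unbounded by blast
    then have "Suc Z \<le> count_list (word_prefix (Suc n) w) \<alpha>"
      using N mono[of N n] by (simp add: word_prefix_Suc)
    then show ?case by blast
  qed simp
  then obtain N where "Z \<le> count_list (word_prefix N w) \<alpha>" by blast
  then show "\<exists>N. \<forall>n\<ge>N. Z \<le> count_list (word_prefix n w) \<alpha>"
    using mono order_trans by blast
qed

text \<open>Every occurrence of \<open>\<beta>\<close> contributes at least one letter to the image,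
  so one non-erased letter suffices for growth.\<close>

lemma length_subst_prefix_tendsto_at_top:
  assumes "w \<in> \<W>" "\<rho> \<beta> \<noteq> []"
  shows "filterlim (\<lambda>n. length (subst_list \<rho> (word_prefix n w))) at_top sequentially"
proof (rule filterlim_at_top_mono[OF count_prefix_tendsto_at_top[OF assms(1), of \<beta>]])
  have "count_list u \<beta> \<le> length (subst_list \<rho> u)" for u
    using assms(2) by (cases \<beta>; cases "\<rho> \<beta>") (auto simp: length_subst_list)
  then show "\<forall>\<^sub>F n in sequentially.
      count_list (word_prefix n w) \<beta> \<le> length (subst_list \<rho> (word_prefix n w))"
    by simp
qed

section \<open>Frequencies of the image, read along images of prefixes\<close>

lemma freq_seq_subst_word_tendsto:
  assumes "w \<in> \<W>" "\<rho> \<beta> \<noteq> []"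
    and lim: "(\<lambda>n. real (count_list (subst_list \<rho> (word_prefix n w)) \<alpha>) /
                real (length (subst_list \<rho> (word_prefix n w)))) \<longlonglongrightarrow> l"
  shows "freq_seq \<alpha> (subst_word \<rho> w) \<longlonglongrightarrow> l"
proof -
  define L where "L = (\<lambda>n. length (subst_list \<rho> (word_prefix n w)))"
  define c where "c = (\<lambda>m. count_list (word_prefix m (subst_word \<rho> w)) \<alpha>)"
  have "(\<lambda>m. real (c m) / real m) \<longlonglongrightarrow> l"
  proof (rule tendsto_ratio_bounded_gaps)
    show "c 0 = 0" by (simp add: c_def word_prefix_def)
    show "c m \<le> c (m + k)" for m k
      by (induction k) (auto simp: c_def word_prefix_Suc)
    show "c (m + k) \<le> c m + k" for m k
      by (induction k) (auto simp: c_def word_prefix_Suc)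
    show "L 0 = 0" by (simp add: L_def word_prefix_def subst_list_def)
    show "mono L"
      by (simp add: mono_iff_le_Suc L_def subst_list_prefix_Suc)
    \<comment> \<open>The sum of the two image lengths bounds the image of the next letter,
      whichever it is; it serves as \<open>K\<close>.\<close>
    show "L (Suc n) \<le> L n + (length (\<rho> La) + length (\<rho> Lb))" for n
      by (cases "w n") (auto simp: L_def subst_list_prefix_Suc)
    show "filterlim L at_top sequentially"
      unfolding L_def by (rule length_subst_prefix_tendsto_at_top[where \<rho> = \<rho> and \<beta> = \<beta>, OF assms(1,2)])
    show "(\<lambda>n. real (c (L n)) / real (L n)) \<longlonglongrightarrow> l"
      using lim by (simp add: c_def L_def word_prefix_subst_word)
  qed
  then show ?thesis by (simp add: c_def freq_seq_def[abs_def])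
qed

text \<open>The easy converse of \<open>freq_seq_subst_word_tendsto\<close>: the lengths tend to
  infinity, so the limit is inherited along them.\<close>

lemma freq_seq_image_tendsto:
  assumes "freq_seq \<alpha> (subst_word \<rho> w) \<longlonglongrightarrow> l" "w \<in> \<W>" "\<rho> \<beta> \<noteq> []"
  shows "(\<lambda>n. real (count_list (subst_list \<rho> (word_prefix n w)) \<alpha>) /
            real (length (subst_list \<rho> (word_prefix n w)))) \<longlonglongrightarrow> l"
  using filterlim_compose[OF assms(1) length_subst_prefix_tendsto_at_top[where \<rho> = \<rho> and \<beta> = \<beta>, OF assms(2,3)]]
  by (simp add: freq_seq_def word_prefix_subst_word)

section \<open>Basic properties of frequencies\<close>

lemma freq_seq_Lb_tendsto:
  assumes "freq_seq La v \<longlonglongrightarrow> l"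
  shows "freq_seq Lb v \<longlonglongrightarrow> 1 - l"
proof (rule Lim_transform_eventually)
  show "(\<lambda>n. 1 - freq_seq La v n) \<longlonglongrightarrow> 1 - l"
    by (intro tendsto_intros assms)
  show "\<forall>\<^sub>F n in sequentially. 1 - freq_seq La v n = freq_seq Lb v n"
  \<comment> \<open>At \<open>n = 0\<close> both quotients have the default value 0, so
    complementarity starts at 1.\<close>
  proof (rule eventually_sequentiallyI[of 1])
    fix n :: nat assume "1 \<le> n"
    moreover have "real n = real (count_list (word_prefix n v) La) + real (count_list (word_prefix n v) Lb)"
      using count_La_plus_Lb[of "word_prefix n v"] by (metis length_word_prefix of_nat_add)
    ultimately show "1 - freq_seq La v n = freq_seq Lb v n"
      by (simp add: freq_seq_def field_simps)
  qed
qed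

lemma freq_exists_Freq_eq:
  assumes "freq_seq \<alpha> v \<longlonglongrightarrow> l"
  shows "freq_exists \<alpha> v" "Freq \<alpha> v = l"
  using assms by (auto simp: freq_exists_def Freq_def convergent_def limI)

lemma freq_exists_tendsto:
  "freq_exists \<alpha> v \<Longrightarrow> freq_seq \<alpha> v \<longlonglongrightarrow> Freq \<alpha> v"
  by (simp add: freq_exists_def Freq_def convergent_LIMSEQ_iff)

text \<open>Allows later statements to assume existence for \<open>La\<close> only; the bounds pass
  to the limit from nonnegative quotients.\<close>

lemma freq_exists_La_imp_Lb:
  assumes "freq_exists La v"
  shows "freq_exists Lb v" "Freq La v + Freq Lb v = 1" "Freq La v \<ge> 0" "Freq Lb v \<ge> 0"
proof -
  have a: "freq_seq La v \<longlonglongrightarrow> Freq La v"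
    using assms by (rule freq_exists_tendsto)
  note b = freq_seq_Lb_tendsto[OF a]
  show "freq_exists Lb v" using freq_exists_Freq_eq[OF b] by simp
  have f: "Freq Lb v = 1 - Freq La v" using freq_exists_Freq_eq[OF b] by simp
  then show "Freq La v + Freq Lb v = 1" by simp
  show "Freq La v \<ge> 0"
    by (rule LIMSEQ_le_const[OF a]) (simp add: freq_seq_def)
  show "Freq Lb v \<ge> 0" unfolding f
    by (rule LIMSEQ_le_const[OF b]) (simp add: freq_seq_def)
qed

section \<open>From the frequencies of a word to those of its image\<close>

text \<open>Counts and length of the image of a prefix are linear in the letter counts of the
  prefix. Dividing both by \<open>n\<close> turns their quotient into a ratio of linear forms in the
  two frequencies, whose denominator has the nonzero limit \<open>D\<close>.\<close>

lemma freq_subst_word: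
  assumes w: "w \<in> \<W>" and fa: "freq_exists La w"
    and D: "D = real (length (\<rho> La)) * Freq La w + real (length (\<rho> Lb)) * Freq Lb w" "D \<noteq> 0"
  shows "freq_seq \<alpha> (subst_word \<rho> w) \<longlonglongrightarrow>
    (real (count_list (\<rho> La) \<alpha>) * Freq La w + real (count_list (\<rho> Lb) \<alpha>) * Freq Lb w) / D"
proof -
  obtain \<beta> where \<beta>: "\<rho> \<beta> \<noteq> []" using D by fastforce
  let ?p = "freq_seq La w" and ?q = "freq_seq Lb w"
  have p: "?p \<longlonglongrightarrow> Freq La w" and q: "?q \<longlonglongrightarrow> Freq Lb w"
    using fa freq_exists_La_imp_Lb(1)[OF fa] by (auto intro: freq_exists_tendsto)
  have "(\<lambda>n. (real (count_list (\<rho> La) \<alpha>) * ?p n + real (count_list (\<rho> Lb) \<alpha>) * ?q n) /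
            (real (length (\<rho> La)) * ?p n + real (length (\<rho> Lb)) * ?q n))
        \<longlonglongrightarrow> (real (count_list (\<rho> La) \<alpha>) * Freq La w + real (count_list (\<rho> Lb) \<alpha>) * Freq Lb w) / D"
    using D by (auto intro!: tendsto_intros p q)
  then have "(\<lambda>n. real (count_list (subst_list \<rho> (word_prefix n w)) \<alpha>) /
                real (length (subst_list \<rho> (word_prefix n w))))
        \<longlonglongrightarrow> (real (count_list (\<rho> La) \<alpha>) * Freq La w + real (count_list (\<rho> Lb) \<alpha>) * Freq Lb w) / D"
  proof (rule Lim_transform_eventually, intro eventually_sequentiallyI[of 1])
    fix n :: nat assume n: "1 \<le> n"
    have "x * ?p n + y * ?q n
        = (real (count_list (word_prefix n w) La) * x + real (count_list (word_prefix n w) Lb) * y) / real n"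
      for x y by (simp add: freq_seq_def add_divide_distrib mult.commute)
    then show "(real (count_list (\<rho> La) \<alpha>) * ?p n + real (count_list (\<rho> Lb) \<alpha>) * ?q n) /
            (real (length (\<rho> La)) * ?p n + real (length (\<rho> Lb)) * ?q n)
        = real (count_list (subst_list \<rho> (word_prefix n w)) \<alpha>) /
                real (length (subst_list \<rho> (word_prefix n w)))"
      using n by (simp add: count_subst_list length_subst_list)
  qed
  then show ?thesis by (rule freq_seq_subst_word_tendsto[where \<rho> = \<rho> and \<beta> = \<beta>, OF w \<beta>])
qed

text \<open>If one letter is erased, the image is periodic and has frequencies whatever \<open>w\<close> is.\<close>

lemma freq_exists_subst_word_erasing:
  assumes w: "w \<in> \<W>" and "\<rho> \<gamma> = []" and \<beta>: "\<rho> \<beta> \<noteq> []"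
  shows "freq_exists \<alpha> (subst_word \<rho> w)"
proof -
  have neq: "\<gamma> \<noteq> \<beta>" using assms by auto
  have c: "count_list (subst_list \<rho> u) \<alpha> = count_list u \<beta> * count_list (\<rho> \<beta>) \<alpha>"
    and l: "length (subst_list \<rho> u) = count_list u \<beta> * length (\<rho> \<beta>)" for u
    using assms(2) neq by (cases \<beta>; cases \<gamma>; simp add: count_subst_list length_subst_list)+
  \<comment> \<open>Once \<open>\<beta>\<close> has occurred, its count cancels as a common nonzero
    factor of the image count and the image length.\<close>
  have "\<forall>\<^sub>F n in sequentially. 1 \<le> count_list (word_prefix n w) \<beta>"
    using count_prefix_tendsto_at_top[OF w, of \<beta>] by (simp add: filterlim_at_top)
  then have "\<forall>\<^sub>F n in sequentially. real (count_list (\<rho> \<beta>) \<alpha>) / real (length (\<rho> \<beta>))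
      = real (count_list (subst_list \<rho> (word_prefix n w)) \<alpha>) /
                real (length (subst_list \<rho> (word_prefix n w)))"
    by eventually_elim (simp add: c l)
  then have "(\<lambda>n. real (count_list (subst_list \<rho> (word_prefix n w)) \<alpha>) /
                real (length (subst_list \<rho> (word_prefix n w))))
      \<longlonglongrightarrow> real (count_list (\<rho> \<beta>) \<alpha>) / real (length (\<rho> \<beta>))"
    by (rule Lim_transform_eventually[OF tendsto_const])
  then show ?thesis
    using freq_seq_subst_word_tendsto[where \<rho> = \<rho> and \<beta> = \<beta>, OF w \<beta>] freq_exists_Freq_eq by blast
qed

text \<open>The frequencies are nonnegative with sum 1, so one of them is positive. With an erased
  letter the sum can vanish, namely when the other letter has frequency 0.\<close>

lemma weighted_freq_pos:
  assumes "freq_exists La w" "\<rho> La \<noteq> []" "\<rho> Lb \<noteq> []"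
  shows "real (length (\<rho> La)) * Freq La w + real (length (\<rho> Lb)) * Freq Lb w > 0"
proof (cases "Freq La w = 0")
  case True then show ?thesis using assms freq_exists_La_imp_Lb[OF assms(1)] by simp
next
  case False then show ?thesis using assms freq_exists_La_imp_Lb[OF assms(1)]
    by (intro add_pos_nonneg) auto
qed

lemma freq_vec_subst_word:
  assumes "w \<in> \<W>" "freq_exists La w"
    and "real (length (\<rho> La)) * Freq La w + real (length (\<rho> Lb)) * Freq Lb w \<noteq> 0"
  shows "freq_vec (subst_word \<rho> w) =
           (1 / (real (length (\<rho> La)) * Freq La w + real (length (\<rho> Lb)) * Freq Lb w)) *\<^sub>R
             (subst_matrix \<rho> *v freq_vec w)"
  using freq_exists_Freq_eq(2)[OF freq_subst_word[OF assms(1,2) refl assms(3)]]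
  by (simp add: vec_eq_iff forall_2 freq_vec_def subst_matrix_def matrix_vector_mult_def sum_2)

section \<open>From the frequencies of the image back to the word\<close>

lemma freq_exists_of_subst_word:
  assumes w: "w \<in> \<W>" and d: "det (subst_matrix \<rho>) \<noteq> 0" and fa: "freq_exists La (subst_word \<rho> w)"
  shows "freq_exists La w"
proof -
  define aa ab ba bb where "aa = real (count_list (\<rho> La) La)" and "ab = real (count_list (\<rho> Lb) La)"
    and "ba = real (count_list (\<rho> La) Lb)" and "bb = real (count_list (\<rho> Lb) Lb)"
  define D where "D = aa * bb - ab * ba"
  have D: "D \<noteq> 0" using d by (simp add: det_2 subst_matrix_def D_def aa_def ab_def ba_def bb_def)
  \<comment> \<open>If \<open>La\<close> were erased, the first column of the matrix would be
    zero.\<close>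
  have ne: "\<rho> La \<noteq> []" using D by (auto simp: D_def aa_def ba_def)
  define p q L where "p = (\<lambda>n. real (count_list (word_prefix n w) La))"
    and "q = (\<lambda>n. real (count_list (word_prefix n w) Lb))"
    and "L = (\<lambda>n. real (length (subst_list \<rho> (word_prefix n w))))"
  define f g where "f = Freq La (subst_word \<rho> w)" and "g = Freq Lb (subst_word \<rho> w)"
  have f: "(\<lambda>n. (p n * aa + q n * ab) / L n) \<longlonglongrightarrow> f"
    using freq_seq_image_tendsto[OF freq_exists_tendsto[OF fa] w ne]
    by (simp add: p_def q_def L_def f_def count_subst_list aa_def ab_def)
  have g: "(\<lambda>n. (p n * ba + q n * bb) / L n) \<longlonglongrightarrow> g"
    using freq_seq_image_tendsto[OF freq_exists_tendsto[OF freq_exists_La_imp_Lb(1)[OF fa]] w ne]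
    by (simp add: p_def q_def L_def g_def count_subst_list ba_def bb_def)
  \<comment> \<open>Cramer's rule for the system with right-hand side \<open>(f, g)\<close>. The
    same elimination at each \<open>n\<close> recovers \<open>p n / L n\<close> and
    \<open>q n / L n\<close>.\<close>
  define x y where "x = (bb * f - ab * g) / D" and "y = (aa * g - ba * f) / D"
  have "(\<lambda>n. (bb * ((p n * aa + q n * ab) / L n) - ab * ((p n * ba + q n * bb) / L n)) / D) \<longlonglongrightarrow> x"
    unfolding x_def by (intro tendsto_intros f g D)
  moreover have "(bb * ((p n * aa + q n * ab) / L n) - ab * ((p n * ba + q n * bb) / L n)) / D
      = p n / L n" for n
  proof -
    have "bb * ((p n * aa + q n * ab) / L n) - ab * ((p n * ba + q n * bb) / L n) = D * p n / L n"
      unfolding D_def by (simp add: diff_divide_distrib[symmetric]) (simp add: algebra_simps)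
    then show ?thesis using D by simp
  qed
  ultimately have x: "(\<lambda>n. p n / L n) \<longlonglongrightarrow> x" by simp
  have "(\<lambda>n. (aa * ((p n * ba + q n * bb) / L n) - ba * ((p n * aa + q n * ab) / L n)) / D) \<longlonglongrightarrow> y"
    unfolding y_def by (intro tendsto_intros f g D)
  moreover have "(aa * ((p n * ba + q n * bb) / L n) - ba * ((p n * aa + q n * ab) / L n)) / D
      = q n / L n" for n
  proof -
    have "aa * ((p n * ba + q n * bb) / L n) - ba * ((p n * aa + q n * ab) / L n) = D * q n / L n"
      unfolding D_def by (simp add: diff_divide_distrib[symmetric]) (simp add: algebra_simps)
    then show ?thesis using D by simp
  qed
  ultimately have y: "(\<lambda>n. q n / L n) \<longlonglongrightarrow> y" by simp
  have pq: "p n + q n = real n" for n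
    using count_La_plus_Lb[of "word_prefix n w"] unfolding p_def q_def
    by (metis length_word_prefix of_nat_add)
  have s: "(\<lambda>n. real n / L n) \<longlonglongrightarrow> x + y"
    using tendsto_add[OF x y] by (simp add: add_divide_distrib[symmetric] pq)
  have Lpos: "\<forall>\<^sub>F n in sequentially. L n > 0"
    using length_subst_prefix_tendsto_at_top[where \<rho> = \<rho> and \<beta> = La, OF w ne]
    unfolding filterlim_at_top L_def by (auto dest!: spec[of _ 1] elim!: eventually_mono)
  define K where "K = real (length (\<rho> La) + length (\<rho> Lb))"
  have K: "K > 0" using ne by (simp add: K_def add_pos_nonneg)
  \<comment> \<open>A single letter has an image of length at most \<open>K\<close>. This keeps
    \<open>n / L n\<close> away from 0, so its limit \<open>x + y\<close> can be divided by.\<close>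
  have LK: "L n \<le> K * real n" for n
  proof -
    have "L n = p n * real (length (\<rho> La)) + q n * real (length (\<rho> Lb))"
      by (simp add: L_def length_subst_list p_def q_def)
    also have "\<dots> \<le> (p n + q n) * K"
      by (simp add: K_def algebra_simps) (simp add: p_def q_def)
    finally show ?thesis by (simp add: pq mult.commute)
  qed
  have "1 / K \<le> x + y"
  proof (rule tendsto_lowerbound[OF s])
    show "\<forall>\<^sub>F n in sequentially. 1 / K \<le> real n / L n"
      using Lpos by eventually_elim (use LK K in \<open>simp add: field_simps\<close>)
  qed simp
  then have pos: "x + y \<noteq> 0" using K by (smt (verit) divide_pos_pos)
  have "freq_seq La w \<longlonglongrightarrow> x / (x + y)"
  proof (rule Lim_transform_eventually)
    show "(\<lambda>n. (p n / L n) / (real n / L n)) \<longlonglongrightarrow> x / (x + y)"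
      by (intro tendsto_intros x s pos)
    show "\<forall>\<^sub>F n in sequentially. (p n / L n) / (real n / L n) = freq_seq La w n"
      using Lpos by eventually_elim (simp add: freq_seq_def p_def)
  qed
  then show ?thesis by (rule freq_exists_Freq_eq)
qed

text \<open>Moving the transpose across the inner product shows that the normalising factor of the
  second formula is a coordinate sum.\<close>

lemma inner_transpose_ones:
  fixes A :: "real ^ 2 ^ 2"
  shows "(transpose A *v vector [1, 1]) \<bullet> x = (A *v x) $ 1 + (A *v x) $ 2"
proof -
  have "(transpose A *v vector [1, 1]) \<bullet> x = vector [1, 1] \<bullet> (A *v x)"
    by (simp add: dot_lmul_matrix)
  then show ?thesis by (simp add: inner_vec_def sum_2)
qed

section \<open>Both formulas together\<close>

text \<open>The disjunction guarding the first formula excludes only a zero denominator: one letter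
  erased and the other of frequency 0. The image frequencies exist even then.\<close>

theorem theorem3p11:
  fixes \<rho> :: substitution and w :: inf_word
  assumes "La \<in> set (subst_list \<rho> [La, Lb])" and "Lb \<in> set (subst_list \<rho> [La, Lb])"
    and "w \<in> \<W>"
  shows
    "(freq_exists La w \<longrightarrow>
        freq_exists Lb w \<and>
        freq_exists La (subst_word \<rho> w) \<and> freq_exists Lb (subst_word \<rho> w) \<and>
        ((\<rho> La \<noteq> [] \<and> \<rho> Lb \<noteq> []) \<or>
            real (length (\<rho> La)) * Freq La w + real (length (\<rho> Lb)) * Freq Lb w \<noteq> 0 \<longrightarrow>
         freq_vec (subst_word \<rho> w) =
           (1 / (real (length (\<rho> La)) * Freq La w + real (length (\<rho> Lb)) * Freq Lb w)) *\<^sub>R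
             (subst_matrix \<rho> *v freq_vec w))) \<and>
     (invertible (subst_matrix \<rho>) \<and> freq_exists La (subst_word \<rho> w) \<longrightarrow>
        freq_exists Lb (subst_word \<rho> w) \<and>
        freq_exists La w \<and> freq_exists Lb w \<and>
        freq_vec w =
          inverse ((transpose (matrix_inv (subst_matrix \<rho>)) *v vector [1, 1]) \<bullet>
                     freq_vec (subst_word \<rho> w)) *\<^sub>R
            (matrix_inv (subst_matrix \<rho>) *v freq_vec (subst_word \<rho> w)))"
proof -
  let ?M = "subst_matrix \<rho>" and ?v = "subst_word \<rho> w"
  let ?D = "real (length (\<rho> La)) * Freq La w + real (length (\<rho> Lb)) * Freq Lb w"
  obtain \<beta> where \<beta>: "\<rho> \<beta> \<noteq> []" using assms(1) by (fastforce simp: subst_list_def)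
  have ex: "freq_exists La ?v" if fa: "freq_exists La w"
  \<comment> \<open>Without erasure the denominator is positive; with erasure it may vanish, so
    existence is taken from the periodic image.\<close>
  proof (cases "\<rho> La \<noteq> [] \<and> \<rho> Lb \<noteq> []")
    case True
    then have "?D \<noteq> 0" using weighted_freq_pos[OF fa, of \<rho>] by simp
    from freq_exists_Freq_eq(1)[OF freq_subst_word[OF assms(3) fa refl this]] show ?thesis .
  next
    case False
    then obtain \<gamma> where "\<rho> \<gamma> = []" by blast
    then show ?thesis by (rule freq_exists_subst_word_erasing[where \<rho> = \<rho>, OF assms(3) _ \<beta>])
  qed
  have vec: "freq_vec ?v = (1 / ?D) *\<^sub>R (?M *v freq_vec w)"
    if "freq_exists La w" "(\<rho> La \<noteq> [] \<and> \<rho> Lb \<noteq> []) \<or> ?D \<noteq> 0"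
    using freq_vec_subst_word[OF assms(3) that(1), of \<rho>] weighted_freq_pos[OF that(1), of \<rho>] that(2)
    by auto
  have conv: "freq_exists La w \<and> freq_vec w =
      inverse ((transpose (matrix_inv ?M) *v vector [1, 1]) \<bullet> freq_vec ?v) *\<^sub>R
        (matrix_inv ?M *v freq_vec ?v)"
    if inv: "invertible ?M" and fv: "freq_exists La ?v"
  proof -
    have d: "det ?M \<noteq> 0" using inv invertible_det_nz by blast
    have fa: "freq_exists La w" by (rule freq_exists_of_subst_word[OF assms(3) d fv])
    \<comment> \<open>An empty image would give a zero column and hence determinant 0.\<close>
    have ne: "\<rho> La \<noteq> []" "\<rho> Lb \<noteq> []"
      using d by (auto simp: det_2 subst_matrix_def)
    have D: "?D > 0" by (rule weighted_freq_pos[OF fa ne])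
    have "matrix_inv ?M *v freq_vec ?v = (1 / ?D) *\<^sub>R ((matrix_inv ?M ** ?M) *v freq_vec w)"
      using vec[OF fa] ne
      by (simp add: matrix_vector_mult_scaleR matrix_vector_mul_assoc)
    \<comment> \<open>\<open>matrix_inv\<close> is defined by choice; invertibility makes the chosen
      matrix an actual inverse.\<close>
    then have x: "matrix_inv ?M *v freq_vec ?v = (1 / ?D) *\<^sub>R freq_vec w"
      using someI_ex[OF inv[unfolded invertible_def]] by (simp add: matrix_inv_def)
    \<comment> \<open>The coordinates of \<open>freq_vec w\<close> sum to 1, so the coordinate sum
      of the vector in \<open>x\<close> is the scaling factor \<open>1 / ?D\<close>, and inverting
      it undoes the scaling.\<close>
    have "(transpose (matrix_inv ?M) *v vector [1, 1]) \<bullet> freq_vec ?v = 1 / ?D"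
      using freq_exists_La_imp_Lb(2)[OF fa]
      unfolding inner_transpose_ones x by (simp add: freq_vec_def add_divide_distrib[symmetric])
    then show ?thesis using fa D by (simp add: x)
  qed
  show ?thesis using ex vec conv freq_exists_La_imp_Lb(1) by blast
qed

end
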